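(* Suppose $(u^*,\alpha^* )$, with $u^*:S\to\mathbb{R}$ and $\alpha^*\in[0,1]$, solves the constant-gain robust Bellman equation $$u^*(s)=\sup_{\phi\in Q}\inf_{p_s\in\mathcal{P}_s}\sum_{a\in A}\sum_{s'\in S}\phi(a)p_s(s'|a)\big[r(s,a)-\alpha^*+u^*(s')\big]\qquad\forall s\in S.$$ Then for every $\mu\in\mathrm{Prob}(S)$, $$\alpha^*=\overline\alpha(\mu,\Pi_H,K_H)=\underline\alpha(\mu,\Pi_H,K_H)=\overline\alpha(\mu,\Pi_S,K_H)=\underline\alpha(\mu,\Pi_S,K_H)=\overline\alpha(\mu,\Pi_S,K_S)=\underline\alpha(\mu,\Pi_S,K_S).$$ Moreover, any other solution $(u,\alpha)\in\{S\to\mathbb{R}\}\times[0,1]$ of the same equation satisfies $\alpha=\alpha^*$.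
   Context: $S$ (states) and $A$ (actions) are finite nonempty sets; $\mathrm{Prob}(E)$ is the set of probability distributions on a finite set $E$; $r:S\times A\to[0,1]$ is a reward function. $Q\subseteq\mathrm{Prob}(A)$ is an arbitrary nonempty set (controller's admissible randomized actions). For each $s\in S$, $\mathcal{P}_s$ is an arbitrary nonempty set of maps $p_s:A\to\mathrm{Prob}(S)$, written $p_s(s'|a)$; $\mathcal{P}=\prod_{s\in S}\mathcal{P}_s$ is the (S-rectangular) ambiguity set, and $p\in\mathcal{P}$ is written $p(s'|s,a)=p_s(s'|a)$. Histories: $h_t=(s_0,a_0,\dots,s_{t-1},a_{t-1},s_t)\in(S\times A)^t\times S$. $\Pi_H$ is the set of history-dependent controller policies $\pi=(\pi_0,\pi_1,\dots)$ with $\pi_t(\cdot|h_t)\in Q$ for all $t,h_t$. $\Pi_S\subseteq\Pi_H$ is the set of stationary ones, $\pi_t(\cdot|h_t)=\Delta(\cdot|s_t)$ for a single map $\Delta:S\to Q$. $K_H$ is the set of history-dependent adversary policies $\kappa=(\kappa_0,\kappa_1,\dots)$ where $\kappa_t(s'|h_t,a)$ is such that $\kappa_t(\cdot|h_t,\cdot)\in\mathcal{P}_{s_t}$ for all $t$, $h_t$. $K_S\subseteq K_H$ is the set of stationary ones, $\kappa_t(s'|h_t,a)=p(s'|s_t,a)$ for a single $p\in\mathcal{P}$. For $\mu\in\mathrm{Prob}(S)$, $\pi$, $\kappa$, $E_\mu^{\pi,\kappa}$ is expectation under the law of $(X_0,A_0,X_1,A_1,\dots)$ with $X_0\sim\mu$,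 $A_t\sim\pi_t(\cdot|H_t)$ given $H_t=(X_0,A_0,\dots,X_t)$, and $X_{t+1}\sim\kappa_t(\cdot|H_t,A_t)$ given $(H_t,A_t)$. Define $$\overline\alpha(\mu,\pi,\kappa)=\limsup_{n\to\infty}E_\mu^{\pi,\kappa}\frac1n\sum_{k=0}^{n-1}r(X_k,A_k),\quad \underline\alpha(\mu,\pi,\kappa)=\liminf_{n\to\infty}E_\mu^{\pi,\kappa}\frac1n\sum_{k=0}^{n-1}r(X_k,A_k),$$ and for policy classes $\Pi,K$: $\overline\alpha(\mu,\Pi,K)=\sup_{\pi\in\Pi}\inf_{\kappa\in K}\overline\alpha(\mu,\pi,\kappa)$, $\underline\alpha(\mu,\Pi,K)=\sup_{\pi\in\Pi}\inf_{\kappa\in K}\underline\alpha(\mu,\pi,\kappa)$. *)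

theory Defs
  imports "HOL-Probability.Probability"
begin

text \<open>
  States and actions are the elements of two types \<open>'s\<close> and \<open>'a\<close> of class \<open>finite\<close>.
  A history \<open>(s\<^sub>0, a\<^sub>0, \<dots>, s\<^sub>t\<^sub>-\<^sub>1, a\<^sub>t\<^sub>-\<^sub>1, s\<^sub>t)\<close> is the pair of the list of the first \<open>t\<close> state-action
  pairs, oldest first, and the current state. The type contains the histories of all lengths, so
  that a whole sequence \<open>(\<pi>\<^sub>0, \<pi>\<^sub>1, \<dots>)\<close>, whose \<open>t\<close>-th member is defined on the histories of
  length \<open>t\<close>, is a single function on it.
\<close>

type_synonym ('s, 'a) history = "('s \<times> 'a) list \<times> 's"
type_synonym ('s, 'a) controller = "('s, 'a) history \<Rightarrow> 'a pmf"
type_synonym ('s, 'a) adversary = "('s, 'a) history \<Rightarrow> 'a \<Rightarrow> 's pmf"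

definition rectangular_set :: "('s \<Rightarrow> ('a \<Rightarrow> 's pmf) set) \<Rightarrow> ('s \<Rightarrow> 'a \<Rightarrow> 's pmf) set"
  where "rectangular_set P = Pi UNIV P"

definition history_controllers :: "'a pmf set \<Rightarrow> ('s, 'a) controller set"
  where "history_controllers Q = {\<pi>. \<forall>h. \<pi> h \<in> Q}"

definition stationary_controllers :: "'a pmf set \<Rightarrow> ('s, 'a) controller set"
  where "stationary_controllers Q =
    {\<pi> \<in> history_controllers Q. \<exists>\<Delta> :: 's \<Rightarrow> 'a pmf. range \<Delta> \<subseteq> Q \<and> (\<forall>h. \<pi> h = \<Delta> (snd h))}"

definition history_adversaries :: "('s \<Rightarrow> ('a \<Rightarrow> 's pmf) set) \<Rightarrow> ('s, 'a) adversary set"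
  where "history_adversaries P = {\<kappa>. \<forall>h. \<kappa> h \<in> P (snd h)}"

definition stationary_adversaries :: "('s \<Rightarrow> ('a \<Rightarrow> 's pmf) set) \<Rightarrow> ('s, 'a) adversary set"
  where "stationary_adversaries P =
    {\<kappa> \<in> history_adversaries P. \<exists>p \<in> rectangular_set P. \<forall>h a. \<kappa> h a = p (snd h) a}"

text \<open>
  A trajectory is a function \<open>\<omega> :: nat \<Rightarrow> 's \<times> 'a\<close> with \<open>\<omega> t = (X\<^sub>t, A\<^sub>t)\<close>.
  The conditional law of \<open>(X\<^sub>t, A\<^sub>t)\<close> given the earlier pairs first draws \<open>X\<^sub>t\<close>, from \<open>\<mu>\<close> at time
  \<open>0\<close> and from the adversary's kernel afterwards, and then draws \<open>A\<^sub>t\<close> given \<open>H\<^sub>t\<close>.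
\<close>

definition history_at :: "(nat \<Rightarrow> 's \<times> 'a) \<Rightarrow> nat \<Rightarrow> ('s, 'a) history"
  where "history_at \<omega> t = (map \<omega> [0..<t], fst (\<omega> t))"

definition next_state ::
  "'s pmf \<Rightarrow> ('s, 'a) adversary \<Rightarrow> nat \<Rightarrow> (nat \<Rightarrow> 's \<times> 'a) \<Rightarrow> 's pmf"
  where "next_state \<mu> \<kappa> t \<omega> =
    (case t of 0 \<Rightarrow> \<mu> | Suc k \<Rightarrow> \<kappa> (history_at \<omega> k) (snd (\<omega> k)))"

definition step_kernel ::
  "'s pmf \<Rightarrow> ('s, 'a) controller \<Rightarrow> ('s, 'a) adversary \<Rightarrow> nat \<Rightarrow> (nat \<Rightarrow> 's \<times> 'a) \<Rightarrow> ('s \<times> 'a) pmf"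
  where "step_kernel \<mu> \<pi> \<kappa> t \<omega> =
    bind_pmf (next_state \<mu> \<kappa> t \<omega>)
      (\<lambda>s. map_pmf (Pair s) (\<pi> (map \<omega> [0..<t], s)))"

text \<open>
  The law of \<open>(X\<^sub>0, A\<^sub>0, X\<^sub>1, A\<^sub>1, \<dots>)\<close> is the Ionescu-Tulcea limit measure of these kernels; the
  lemmas below show that the locale applies and compute the law on cylinder sets.
\<close>

definition trajectory_law ::
  "'s pmf \<Rightarrow> ('s, 'a) controller \<Rightarrow> ('s, 'a) adversary \<Rightarrow> (nat \<Rightarrow> 's \<times> 'a) measure"
  where "trajectory_law \<mu> \<pi> \<kappa> =
    projective_family.lim UNIV
      (Ionescu_Tulcea.CI (\<lambda>t \<omega>. measure_pmf (step_kernel \<mu> \<pi> \<kappa> t \<omega>)) (\<lambda>_. count_space UNIV))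
      (\<lambda>_. count_space UNIV)"

definition expected_average ::
  "('s \<Rightarrow> 'a \<Rightarrow> real) \<Rightarrow> 's pmf \<Rightarrow> ('s, 'a) controller \<Rightarrow> ('s, 'a) adversary \<Rightarrow> nat \<Rightarrow> real"
  where "expected_average r \<mu> \<pi> \<kappa> n =
    (\<integral>\<omega>. (1 / real n) * (\<Sum>k<n. r (fst (\<omega> k)) (snd (\<omega> k))) \<partial>trajectory_law \<mu> \<pi> \<kappa>)"

definition upper_gain ::
  "('s \<Rightarrow> 'a \<Rightarrow> real) \<Rightarrow> 's pmf \<Rightarrow> ('s, 'a) controller \<Rightarrow> ('s, 'a) adversary \<Rightarrow> ereal"
  where "upper_gain r \<mu> \<pi> \<kappa> = limsup (\<lambda>n. ereal (expected_average r \<mu> \<pi> \<kappa> n))"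

definition lower_gain ::
  "('s \<Rightarrow> 'a \<Rightarrow> real) \<Rightarrow> 's pmf \<Rightarrow> ('s, 'a) controller \<Rightarrow> ('s, 'a) adversary \<Rightarrow> ereal"
  where "lower_gain r \<mu> \<pi> \<kappa> = liminf (\<lambda>n. ereal (expected_average r \<mu> \<pi> \<kappa> n))"

definition upper_value ::
  "('s \<Rightarrow> 'a \<Rightarrow> real) \<Rightarrow> 's pmf \<Rightarrow> ('s, 'a) controller set \<Rightarrow> ('s, 'a) adversary set \<Rightarrow> ereal"
  where "upper_value r \<mu> C K = (SUP \<pi>\<in>C. INF \<kappa>\<in>K. upper_gain r \<mu> \<pi> \<kappa>)"

definition lower_value ::
  "('s \<Rightarrow> 'a \<Rightarrow> real) \<Rightarrow> 's pmf \<Rightarrow> ('s, 'a) controller set \<Rightarrow> ('s, 'a) adversary set \<Rightarrow> ereal"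
  where "lower_value r \<mu> C K = (SUP \<pi>\<in>C. INF \<kappa>\<in>K. lower_gain r \<mu> \<pi> \<kappa>)"

text \<open>
  The supremum and infimum are those of \<open>real\<close>. For nonempty \<open>Q\<close> and \<open>P s\<close> they are genuine, because
  the double sum is an average of the values of \<open>r s a - \<alpha> + u s'\<close>, hence bounded.
\<close>

definition bellman_solution ::
  "('s::finite \<Rightarrow> 'a::finite \<Rightarrow> real) \<Rightarrow> 'a pmf set \<Rightarrow> ('s \<Rightarrow> ('a \<Rightarrow> 's pmf) set) \<Rightarrow>
    ('s \<Rightarrow> real) \<Rightarrow> real \<Rightarrow> bool"
  where "bellman_solution r Q P u \<alpha> \<longleftrightarrow>
    (\<forall>s. u s = (SUP \<phi>\<in>Q. INF p\<in>P s.
       \<Sum>a\<in>UNIV. \<Sum>s'\<in>UNIV. pmf \<phi> a * pmf (p a) s' * (r s a - \<alpha> + u s')))"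

lemma step_kernel_cong:
  assumes "\<And>i. i < t \<Longrightarrow> \<omega> i = \<omega>' i"
  shows "step_kernel \<mu> \<pi> \<kappa> t \<omega> = step_kernel \<mu> \<pi> \<kappa> t \<omega>'"
proof -
  have "map \<omega> [0..<t] = map \<omega>' [0..<t]"
    using assms by simp
  moreover have "next_state \<mu> \<kappa> t \<omega> = next_state \<mu> \<kappa> t \<omega>'"
  proof (cases t)
    case (Suc k)
    then have "map \<omega> [0..<k] = map \<omega>' [0..<k]" "\<omega> k = \<omega>' k"
      using assms by auto
    then show ?thesis
      by (simp only: Suc next_state_def history_at_def nat.case)
  qed (simp add: next_state_def)
  ultimately show ?thesis
    by (simp only: step_kernel_def)
qed

lemma pmf_step_kernel:
  "pmf (step_kernel \<mu> \<pi> \<kappa> t \<omega>) (s, a) =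
    pmf (next_state \<mu> \<kappa> t \<omega>) s * pmf (\<pi> (map \<omega> [0..<t], s)) a"
proof -
  have eq: "pmf (map_pmf (Pair x) (\<pi> (map \<omega> [0..<t], x))) (s, a) =
      indicator {s} x * pmf (\<pi> (map \<omega> [0..<t], s)) a" for x
  proof (cases "x = s")
    case True
    then show ?thesis
      by (simp add: pmf_map_inj' inj_on_def)
  next
    case False
    then have "(s, a) \<notin> set_pmf (map_pmf (Pair x) (\<pi> (map \<omega> [0..<t], x)))"
      by auto
    then have "pmf (map_pmf (Pair x) (\<pi> (map \<omega> [0..<t], x))) (s, a) = 0"
      by (simp only: set_pmf_iff not_not)
    with False show ?thesis
      by simp
  qed
  show ?thesis
    unfolding step_kernel_def pmf_bind eq by (simp add: measure_pmf_single)
qed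

lemma Ionescu_Tulcea_step_kernel:
  fixes \<mu> :: "'s::finite pmf" and \<pi> :: "('s, 'a::finite) controller"
  shows "Ionescu_Tulcea (\<lambda>t \<omega>. measure_pmf (step_kernel \<mu> \<pi> \<kappa> t \<omega>)) (\<lambda>_. count_space UNIV)"
proof
  fix t
  show "(\<lambda>\<omega>. measure_pmf (step_kernel \<mu> \<pi> \<kappa> t \<omega>))
      \<in> PiM {0..<t} (\<lambda>_. count_space UNIV) \<rightarrow>\<^sub>M subprob_algebra (count_space UNIV)"
    by (simp add: count_space_PiM_finite measure_pmf_in_subprob_algebra)
qed

lemma prob_space_trajectory_law:
  fixes \<mu> :: "'s::finite pmf" and \<pi> :: "('s, 'a::finite) controller"
  shows "prob_space (trajectory_law \<mu> \<pi> \<kappa>)"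
proof -
  interpret Ionescu_Tulcea "\<lambda>t \<omega>. measure_pmf (step_kernel \<mu> \<pi> \<kappa> t \<omega>)"
      "\<lambda>_. count_space (UNIV :: ('s \<times> 'a) set)"
    by (rule Ionescu_Tulcea_step_kernel)
  have e: "PF.emb UNIV {} {\<lambda>_. undefined} = space PF.lim"
    by (auto simp: prod_emb_def space_PiM)
  have "emeasure PF.lim (PF.emb UNIV {} {\<lambda>_. undefined}) = emeasure (CI {}) {\<lambda>_. undefined}"
    by (rule lim) (auto simp: PiM_empty)
  also have "\<dots> = 1"
    using prob_space.emeasure_space_1[OF PF.prob_space_P, of "{}"] by (simp add: PF.space_P space_PiM)
  finally show ?thesis
    unfolding trajectory_law_def e by (rule prob_spaceI)
qed

lemma emeasure_trajectory_law_cylinder: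
  fixes \<mu> :: "'s::finite pmf" and \<pi> :: "('s, 'a::finite) controller"
  shows "emeasure (trajectory_law \<mu> \<pi> \<kappa>) {\<omega>. \<forall>i<n. \<omega> i = x i} =
    (\<Prod>i<n. ennreal (pmf (step_kernel \<mu> \<pi> \<kappa> i x) (x i)))"
proof -
  let ?M = "\<lambda>_::nat. count_space (UNIV :: ('s \<times> 'a) set)"
  interpret Ionescu_Tulcea "\<lambda>t \<omega>. measure_pmf (step_kernel \<mu> \<pi> \<kappa> t \<omega>)" ?M
    by (rule Ionescu_Tulcea_step_kernel)
  define y where "y m = restrict x {0..<m}" for m
  have sp: "y m \<in> space (PiM {0..<m} ?M)" for m
    by (auto simp: y_def space_PiM)
  have sets: "{y m} \<in> sets (PiM {0..<m} ?M)" for m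
    using sp[of m] by (simp add: count_space_PiM_finite space_PiM)
  have und: "(\<lambda>_. undefined) \<in> space (PiM {0..<0} ?M)"
    by (simp add: space_PiM)
  have C: "emeasure (C 0 m (\<lambda>_. undefined)) {y m} =
      (\<Prod>i<m. ennreal (pmf (step_kernel \<mu> \<pi> \<kappa> i x) (x i)))" for m
  proof (induction m)
    case 0
    have "y 0 = (\<lambda>_. undefined)"
      by (auto simp: y_def)
    then show ?case
      using sets[of 0] by (simp add: indicator_def)
  next
    case (Suc m)
    have e: "emeasure (eP m \<omega>) {y (Suc m)} =
        ennreal (pmf (step_kernel \<mu> \<pi> \<kappa> m x) (x m)) * indicator {y m} \<omega>"
      if w: "\<omega> \<in> space (PiM {0..<m} ?M)" for \<omega>
    proof -
      have ext: "\<omega> i = undefined" if "i \<ge> m" for i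
        using w that by (auto simp: space_PiM PiE_def extensional_def)
      have iff: "fun_upd \<omega> m z = y (Suc m) \<longleftrightarrow> z = x m \<and> \<omega> = y m" for z
      proof
        assume *: "fun_upd \<omega> m z = y (Suc m)"
        have "z = x m"
          using fun_cong[OF *, of m] by (simp add: y_def)
        moreover have "\<omega> i = y m i" for i
          using fun_cong[OF *, of i] ext[of i]
          by (cases "i < m") (auto simp: y_def)
        ultimately show "z = x m \<and> \<omega> = y m" by auto
      qed (auto simp: y_def fun_eq_iff)
      have *: "emeasure (eP m \<omega>) {y (Suc m)} =
          emeasure (measure_pmf (step_kernel \<mu> \<pi> \<kappa> m \<omega>)) {z. fun_upd \<omega> m z = y (Suc m)}"
        by (subst emeasure_eP[OF w sets]) (simp add: vimage_def)
      show ?thesis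
      proof (cases "\<omega> = y m")
        case True
        have "step_kernel \<mu> \<pi> \<kappa> m \<omega> = step_kernel \<mu> \<pi> \<kappa> m x"
          by (rule step_kernel_cong) (simp add: True y_def)
        then show ?thesis
          unfolding * iff using True by (simp add: emeasure_pmf_single)
      qed (simp add: * iff)
    qed
    have "emeasure (C 0 (Suc m) (\<lambda>_. undefined)) {y (Suc m)} =
        (\<integral>\<^sup>+\<omega>. emeasure (eP m \<omega>) {y (Suc m)} \<partial>C 0 m (\<lambda>_. undefined))"
      using prob_space.not_empty[OF prob_space_C[OF und, of m]] measurable_eP[of m]
      by (simp add: emeasure_bind[OF _ _ sets]
            measurable_cong_sets[OF sets_C[OF und]] space_C[OF und])
    also have "\<dots> = (\<integral>\<^sup>+\<omega>. ennreal (pmf (step_kernel \<mu> \<pi> \<kappa> m x) (x m)) * indicator {y m} \<omega>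
        \<partial>C 0 m (\<lambda>_. undefined))"
      by (intro nn_integral_cong e) (simp add: space_C[OF und])
    also have "\<dots> = ennreal (pmf (step_kernel \<mu> \<pi> \<kappa> m x) (x m)) *
        emeasure (C 0 m (\<lambda>_. undefined)) {y m}"
      using sets[of m] by (subst nn_integral_cmult_indicator) (simp_all add: sets_C[OF und])
    finally show ?case
      by (simp add: Suc.IH mult.commute)
  qed
  have emb: "PF.emb UNIV {0..<n} {y n} = {\<omega>. \<forall>i<n. \<omega> i = x i}"
    by (auto simp: prod_emb_def space_PiM y_def fun_eq_iff) metis
  have "emeasure PF.lim (PF.emb UNIV {0..<n} {y n}) = emeasure (CI {0..<n}) {y n}"
    by (rule lim) (simp_all add: sets)
  also have "\<dots> = emeasure (C 0 n (\<lambda>_. undefined)) {y n}"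
    using sp[of n] by (subst emeasure_CI[OF order_refl sets]) (simp add: prod_emb_id space_PiM)
  finally show ?thesis
    unfolding trajectory_law_def emb C .
qed

end

theory Submission
  imports Defs
begin

text \<open>
  A solution \<open>(u, \<alpha>)\<close> of the Bellman equation turns \<open>u\<close> into a potential for the game. Fix \<open>e > 0\<close>.
  Since \<open>u s\<close> is a supremum over \<open>Q\<close> of infima over \<open>P s\<close>, two near-optimal choices exist. In every
  state the controller has an action law \<open>\<Delta> s\<close> for which, whatever the adversary does, the expected
  reward plus the expected new potential is at least \<open>u s + \<alpha> - e\<close>; and against every action law \<open>\<phi>\<close>
  in state \<open>s\<close> the adversary has a reply for which that quantity is at most \<open>u s + \<alpha> + e\<close>
  (\<open>bellman_controller_choice\<close>, \<open>bellman_adversary_choice\<close>).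

  Taking expectations along a trajectory, such a one-step inequality at every history telescopes:
  the expected reward of the first \<open>n\<close> steps differs from \<open>n\<close> times the drift constant only by the
  potentials at the two ends, and these stay bounded because the state space is finite. After
  division by \<open>n\<close> the end terms vanish, so the gain is at most, or at least, the drift constant
  (\<open>upper_gain_le\<close>, \<open>lower_gain_ge\<close>).

  The policy \<open>\<Delta>\<close> is stationary and secures \<open>\<alpha> - e\<close> in the lower gain against every history-dependent
  adversary, hence against every smaller class. The adversary's reply depends only on the current
  action law and the current state, so it is stationary as soon as the controller is; it holds the
  upper gain to \<open>\<alpha> + e\<close>. Hence \<open>\<alpha>\<close> is at most every lower value and at least every upper value
  in question, for each pair of classes closed under these two constructions
  (\<open>bellman_gain_eq_values\<close>). As the values do not mention \<open>u\<close>, the constant \<open>\<alpha>\<close> is unique.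
\<close>

section \<open>Conditioning a trajectory on its past\<close>

lemma sets_trajectory_law:
  fixes \<mu> :: "'s::finite pmf" and \<pi> :: "('s, 'a::finite) controller"
  shows "sets (trajectory_law \<mu> \<pi> \<kappa>) = sets (PiM UNIV (\<lambda>_. count_space UNIV))"
proof -
  interpret Ionescu_Tulcea "\<lambda>t \<omega>. measure_pmf (step_kernel \<mu> \<pi> \<kappa> t \<omega>)"
      "\<lambda>_. count_space (UNIV :: ('s \<times> 'a) set)"
    by (rule Ionescu_Tulcea_step_kernel)
  show ?thesis
    unfolding trajectory_law_def by simp
qed

lemma prefix_eq_iff: "map \<omega> [0..<n] = xs \<longleftrightarrow> length xs = n \<and> (\<forall>i<n. \<omega> i = xs ! i)"
  by (auto simp: list_eq_iff_nth_eq)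

lemma sets_prefix:
  fixes \<mu> :: "'s::finite pmf" and \<pi> :: "('s, 'a::finite) controller"
  shows "{\<omega>. map \<omega> [0..<n] = xs} \<in> sets (trajectory_law \<mu> \<pi> \<kappa>)"
proof -
  have "{\<omega> \<in> space (PiM UNIV (\<lambda>_. count_space UNIV)).
      length xs = n \<and> (\<forall>i<n. \<omega> i = xs ! i)} \<in>
    sets (PiM UNIV (\<lambda>_::nat. count_space (UNIV :: ('s \<times> 'a) set)))"
    by measurable
  then show ?thesis
    by (simp add: sets_trajectory_law prefix_eq_iff space_PiM)
qed

lemma finite_length_lists: "finite {xs :: 'x::finite list. length xs = n}"
  using finite_lists_length_eq[of "UNIV :: 'x set" n] by simp

text \<open>
  With finitely many states and actions, a function of the first \<open>n\<close> pairs is a simple function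
  over cylinder sets. Integrability is then automatic and every expectation of this kind is a finite
  sum of cylinder probabilities.
\<close>

lemma prefix_function_as_sum:
  fixes F :: "'x::finite list \<Rightarrow> real"
  shows "F (map \<omega> [0..<n]) =
    (\<Sum>xs | length xs = n. F xs * indicator {\<omega>. map \<omega> [0..<n] = xs} \<omega>)"
proof -
  have "F xs * indicator {\<omega>. map \<omega> [0..<n] = xs} \<omega> =
      (if xs = map \<omega> [0..<n] then F xs else 0)" for xs
    by (auto simp: indicator_def)
  then show ?thesis
    by (simp add: sum.delta finite_length_lists)
qed

lemma
  fixes \<mu> :: "'s::finite pmf" and \<pi> :: "('s, 'a::finite) controller"
    and F :: "('s \<times> 'a) list \<Rightarrow> real"
  shows integrable_prefix: "integrable (trajectory_law \<mu> \<pi> \<kappa>) (\<lambda>\<omega>. F (map \<omega> [0..<n]))"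
    and integral_prefix: "(\<integral>\<omega>. F (map \<omega> [0..<n]) \<partial>trajectory_law \<mu> \<pi> \<kappa>) =
      (\<Sum>xs | length xs = n. F xs * measure (trajectory_law \<mu> \<pi> \<kappa>) {\<omega>. map \<omega> [0..<n] = xs})"
proof -
  interpret prob_space "trajectory_law \<mu> \<pi> \<kappa>"
    by (rule prob_space_trajectory_law)
  have int: "integrable (trajectory_law \<mu> \<pi> \<kappa>)
      (\<lambda>\<omega>. F xs * indicator {\<omega>. map \<omega> [0..<n] = xs} \<omega>)" for xs
    by (intro integrable_mult_right integrable_real_indicator)
      (simp_all add: sets_prefix less_top[symmetric])
  show "integrable (trajectory_law \<mu> \<pi> \<kappa>) (\<lambda>\<omega>. F (map \<omega> [0..<n]))"
    by (subst prefix_function_as_sum) (intro Bochner_Integration.integrable_sum int)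
  show "(\<integral>\<omega>. F (map \<omega> [0..<n]) \<partial>trajectory_law \<mu> \<pi> \<kappa>) =
      (\<Sum>xs | length xs = n. F xs * measure (trajectory_law \<mu> \<pi> \<kappa>) {\<omega>. map \<omega> [0..<n] = xs})"
    by (subst prefix_function_as_sum, subst Bochner_Integration.integral_sum[OF int])
      (simp add: sets.Int_space_eq2 sets_prefix)
qed

lemma measure_prefix:
  fixes \<mu> :: "'s::finite pmf" and \<pi> :: "('s, 'a::finite) controller"
  assumes "length xs = n"
  shows "measure (trajectory_law \<mu> \<pi> \<kappa>) {\<omega>. map \<omega> [0..<n] = xs} =
    (\<Prod>i<n. pmf (step_kernel \<mu> \<pi> \<kappa> i (nth xs)) (xs ! i))"
  using assms emeasure_trajectory_law_cylinder[of \<mu> \<pi> \<kappa> n "nth xs"]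
  by (simp add: prefix_eq_iff measure_def prod_ennreal prod_nonneg)

lemma measure_prefix_snoc:
  fixes \<mu> :: "'s::finite pmf" and \<pi> :: "('s, 'a::finite) controller"
  assumes "length xs = n"
  shows "measure (trajectory_law \<mu> \<pi> \<kappa>) {\<omega>. map \<omega> [0..<Suc n] = xs @ [z]} =
    measure (trajectory_law \<mu> \<pi> \<kappa>) {\<omega>. map \<omega> [0..<n] = xs} *
      pmf (step_kernel \<mu> \<pi> \<kappa> n (nth xs)) z"
proof -
  have "step_kernel \<mu> \<pi> \<kappa> i (nth (xs @ [z])) = step_kernel \<mu> \<pi> \<kappa> i (nth xs)" if "i \<le> n" for i
    using that assms by (intro step_kernel_cong) (simp add: nth_append)
  then show ?thesis
    using assms by (simp add: measure_prefix nth_append del: upt_Suc)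
qed

text \<open>
  The tower property: conditioning on the first \<open>n\<close> pairs replaces the next pair by its average
  under the kernel. It is the product formula for cylinder probabilities, summed over all words.
\<close>

lemma expectation_one_step:
  fixes \<mu> :: "'s::finite pmf" and \<pi> :: "('s, 'a::finite) controller"
    and G :: "('s \<times> 'a) list \<Rightarrow> 's \<times> 'a \<Rightarrow> real"
  shows "(\<integral>\<omega>. G (map \<omega> [0..<n]) (\<omega> n) \<partial>trajectory_law \<mu> \<pi> \<kappa>) =
    (\<integral>\<omega>. (\<Sum>z\<in>UNIV. pmf (step_kernel \<mu> \<pi> \<kappa> n \<omega>) z * G (map \<omega> [0..<n]) z)
      \<partial>trajectory_law \<mu> \<pi> \<kappa>)"
proof -
  let ?m = "\<lambda>n xs. measure (trajectory_law \<mu> \<pi> \<kappa>) {\<omega>. map \<omega> [0..<n] = xs}"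
  let ?F = "\<lambda>xs. \<Sum>z\<in>UNIV. pmf (step_kernel \<mu> \<pi> \<kappa> n (nth xs)) z * G xs z"
  have kernel: "step_kernel \<mu> \<pi> \<kappa> n \<omega> = step_kernel \<mu> \<pi> \<kappa> n (nth (map \<omega> [0..<n]))" for \<omega>
    by (rule step_kernel_cong) simp
  \<comment> \<open>A word of length \<open>Suc n\<close> is a past of length \<open>n\<close> followed by the present pair.\<close>
  have bij: "bij_betw (\<lambda>(xs, z). xs @ [z]) ({xs. length xs = n} \<times> UNIV)
      {xs :: ('s \<times> 'a) list. length xs = Suc n}"
    by (rule bij_betw_byWitness[where f' = "\<lambda>xs. (butlast xs, last xs)"])
      (auto simp: length_Suc_conv_rev)
  have "(\<integral>\<omega>. G (map \<omega> [0..<n]) (\<omega> n) \<partial>trajectory_law \<mu> \<pi> \<kappa>) =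
      (\<integral>\<omega>. (\<lambda>xs. G (butlast xs) (last xs)) (map \<omega> [0..<Suc n]) \<partial>trajectory_law \<mu> \<pi> \<kappa>)"
    by simp
  also have "\<dots> = (\<Sum>xs | length xs = Suc n. G (butlast xs) (last xs) * ?m (Suc n) xs)"
    by (rule integral_prefix)
  also have "\<dots> = (\<Sum>(xs, z) \<in> {xs. length xs = n} \<times> UNIV. G xs z * ?m (Suc n) (xs @ [z]))"
    by (subst sum.reindex_bij_betw[OF bij, symmetric])
      (simp add: case_prod_beta del: upt_Suc)
  also have "\<dots> = (\<Sum>xs | length xs = n. \<Sum>z\<in>UNIV. G xs z * ?m (Suc n) (xs @ [z]))"
    by (rule sum.cartesian_product[symmetric])
  also have "\<dots> = (\<Sum>xs | length xs = n. ?F xs * ?m n xs)"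
    by (intro sum.cong refl)
      (simp add: measure_prefix_snoc sum_distrib_left mult_ac del: upt_Suc)
  also have "\<dots> = (\<integral>\<omega>. ?F (map \<omega> [0..<n]) \<partial>trajectory_law \<mu> \<pi> \<kappa>)"
    by (rule integral_prefix[symmetric])
  also have "\<dots> = (\<integral>\<omega>. (\<Sum>z\<in>UNIV. pmf (step_kernel \<mu> \<pi> \<kappa> n \<omega>) z * G (map \<omega> [0..<n]) z)
      \<partial>trajectory_law \<mu> \<pi> \<kappa>)"
    by (simp only: kernel[symmetric])
  finally show ?thesis .
qed

lemma sum_step_kernel:
  fixes g :: "'s::finite \<Rightarrow> 'a::finite \<Rightarrow> real"
  shows "(\<Sum>z\<in>UNIV. pmf (step_kernel \<mu> \<pi> \<kappa> n \<omega>) z * g (fst z) (snd z)) =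
    (\<Sum>s\<in>UNIV. pmf (next_state \<mu> \<kappa> n \<omega>) s *
      (\<Sum>a\<in>UNIV. pmf (\<pi> (map \<omega> [0..<n], s)) a * g s a))"
proof -
  have "(\<Sum>z\<in>UNIV. pmf (step_kernel \<mu> \<pi> \<kappa> n \<omega>) z * g (fst z) (snd z)) =
      (\<Sum>s\<in>UNIV. \<Sum>a\<in>UNIV. pmf (step_kernel \<mu> \<pi> \<kappa> n \<omega>) (s, a) * g s a)"
    by (simp add: sum.cartesian_product case_prod_beta)
  then show ?thesis
    by (simp add: pmf_step_kernel sum_distrib_left mult.assoc)
qed

lemma sum_pmf_UNIV: "(\<Sum>x\<in>UNIV. pmf (p :: 'x::finite pmf) x) = 1"
  by (rule sum_pmf_eq_1) auto

lemma expectation_state: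
  fixes \<mu> :: "'s::finite pmf" and \<pi> :: "('s, 'a::finite) controller" and u :: "'s \<Rightarrow> real"
  shows "(\<integral>\<omega>. u (fst (\<omega> n)) \<partial>trajectory_law \<mu> \<pi> \<kappa>) =
    (\<integral>\<omega>. (\<Sum>s\<in>UNIV. pmf (next_state \<mu> \<kappa> n \<omega>) s * u s) \<partial>trajectory_law \<mu> \<pi> \<kappa>)"
  using expectation_one_step[where G = "\<lambda>_ z. u (fst z)"]
  by (simp add: sum_step_kernel[where g = "\<lambda>s _. u s"] sum_distrib_right[symmetric] sum_pmf_UNIV)

lemma integrable_history:
  fixes \<mu> :: "'s::finite pmf" and \<pi> :: "('s, 'a::finite) controller"
    and F :: "('s \<times> 'a) list \<Rightarrow> 's \<times> 'a \<Rightarrow> real"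
  shows "integrable (trajectory_law \<mu> \<pi> \<kappa>) (\<lambda>\<omega>. F (map \<omega> [0..<n]) (\<omega> n))"
  using integrable_prefix[of \<mu> \<pi> \<kappa> "\<lambda>xs. F (butlast xs) (last xs)" "Suc n"] by simp

text \<open>
  The law of the next state only looks at the past, so its averages are functions of a prefix and
  \<open>integrable_prefix\<close> covers them.
\<close>

lemma next_state_prefix:
  "next_state \<mu> \<kappa> n \<omega> = next_state \<mu> \<kappa> n (nth (map \<omega> [0..<n]))"
proof (cases n)
  case (Suc k)
  have "map (nth (map \<omega> [0..<Suc k])) [0..<k] = map \<omega> [0..<k]"
    by (simp add: list_eq_iff_nth_eq del: upt_Suc)
  moreover have "map \<omega> [0..<Suc k] ! k = \<omega> k"
    by (simp add: nth_append)
  ultimately show ?thesis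
    unfolding Suc next_state_def history_at_def nat.case by (simp only:)
qed (simp add: next_state_def)

section \<open>Drift of a potential and the accumulated reward\<close>

text \<open>
  The hypothesis bounds the conditional expectation of \<open>r (X\<^sub>n, A\<^sub>n) - c + u (X\<^sub>n\<^sub>+\<^sub>1)\<close> given \<open>H\<^sub>n\<close>. To
  reach the unconditional inequality the tower property is used at two times: at \<open>n + 1\<close> to average
  over the new state, then at \<open>n\<close> to average over the current pair.
\<close>

lemma expected_reward_drift:
  fixes \<mu> :: "'s::finite pmf" and \<pi> :: "('s, 'a::finite) controller"
    and r :: "'s \<Rightarrow> 'a \<Rightarrow> real" and u :: "'s \<Rightarrow> real"
  assumes drift: "\<And>h. (\<Sum>a\<in>UNIV. \<Sum>s'\<in>UNIV.
      pmf (\<pi> h) a * pmf (\<kappa> h a) s' * (r (snd h) a - c + u s')) \<le> u (snd h)"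
  shows "(\<integral>\<omega>. r (fst (\<omega> n)) (snd (\<omega> n)) \<partial>trajectory_law \<mu> \<pi> \<kappa>)
      + (\<integral>\<omega>. u (fst (\<omega> (Suc n))) \<partial>trajectory_law \<mu> \<pi> \<kappa>)
    \<le> c + (\<integral>\<omega>. u (fst (\<omega> n)) \<partial>trajectory_law \<mu> \<pi> \<kappa>)"
proof -
  let ?M = "trajectory_law \<mu> \<pi> \<kappa>"
  interpret prob_space ?M
    by (rule prob_space_trajectory_law)
  \<comment> \<open>The conditional expectation given the history and the action.\<close>
  define g where "g xs s a = r s a - c + (\<Sum>s'\<in>UNIV. pmf (\<kappa> (xs, s) a) s' * u s')" for xs s a
  have le: "(\<Sum>a\<in>UNIV. pmf (\<pi> (xs, s)) a * g xs s a) \<le> u s" for xs s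
  proof -
    have "(\<Sum>a\<in>UNIV. pmf (\<pi> (xs, s)) a * g xs s a) = (\<Sum>a\<in>UNIV. \<Sum>s'\<in>UNIV.
        pmf (\<pi> (xs, s)) a * pmf (\<kappa> (xs, s) a) s' * (r s a - c + u s'))"
    proof (rule sum.cong[OF refl])
      fix a
      have "(\<Sum>s'\<in>UNIV. pmf (\<kappa> (xs, s) a) s' * (r s a - c + u s')) = g xs s a"
        by (simp add: g_def ring_distribs sum.distrib sum_subtractf
            sum_distrib_right[symmetric] sum_pmf_UNIV)
      then show "pmf (\<pi> (xs, s)) a * g xs s a = (\<Sum>s'\<in>UNIV.
          pmf (\<pi> (xs, s)) a * pmf (\<kappa> (xs, s) a) s' * (r s a - c + u s'))"
        by (simp add: mult.assoc sum_distrib_left[symmetric])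
    qed
    then show ?thesis
      using drift[of "(xs, s)"] by simp
  qed
  have int_r: "integrable ?M (\<lambda>\<omega>. r (fst (\<omega> n)) (snd (\<omega> n)))"
    by (rule integrable_history[of _ _ _ "\<lambda>_ z. r (fst z) (snd z)"])
  have int_u: "integrable ?M (\<lambda>\<omega>. \<Sum>s'\<in>UNIV.
      pmf (\<kappa> (map \<omega> [0..<n], fst (\<omega> n)) (snd (\<omega> n))) s' * u s')"
    by (rule integrable_history[of _ _ _
          "\<lambda>xs z. \<Sum>s'\<in>UNIV. pmf (\<kappa> (xs, fst z) (snd z)) s' * u s'"])
  have int_n: "integrable ?M
      (\<lambda>\<omega>. \<Sum>s\<in>UNIV. pmf (next_state \<mu> \<kappa> n \<omega>) s * f (map \<omega> [0..<n]) s)"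
    for f :: "('s \<times> 'a) list \<Rightarrow> 's \<Rightarrow> real"
    by (subst next_state_prefix)
      (rule integrable_prefix[of _ _ _
          "\<lambda>xs. \<Sum>s\<in>UNIV. pmf (next_state \<mu> \<kappa> n (nth xs)) s * f xs s"])
  have "(\<integral>\<omega>. r (fst (\<omega> n)) (snd (\<omega> n)) \<partial>?M) + (\<integral>\<omega>. u (fst (\<omega> (Suc n))) \<partial>?M) - c =
      (\<integral>\<omega>. g (map \<omega> [0..<n]) (fst (\<omega> n)) (snd (\<omega> n)) \<partial>?M)"
    unfolding g_def expectation_state[where u = u and n = "Suc n"] next_state_def history_at_def nat.case
    using int_r int_u by (simp add: prob_space)
  also have "\<dots> = (\<integral>\<omega>. (\<Sum>s\<in>UNIV. pmf (next_state \<mu> \<kappa> n \<omega>) s *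
      (\<Sum>a\<in>UNIV. pmf (\<pi> (map \<omega> [0..<n], s)) a * g (map \<omega> [0..<n]) s a)) \<partial>?M)"
    using expectation_one_step[where G = "\<lambda>xs z. g xs (fst z) (snd z)"]
    by (simp only: sum_step_kernel)
  also have "\<dots> \<le> (\<integral>\<omega>. (\<Sum>s\<in>UNIV. pmf (next_state \<mu> \<kappa> n \<omega>) s * u s) \<partial>?M)"
    by (intro integral_mono int_n[of "\<lambda>xs s. \<Sum>a\<in>UNIV. pmf (\<pi> (xs, s)) a * g xs s a"]
        int_n[of "\<lambda>_. u"] sum_mono mult_left_mono le pmf_nonneg)
  also have "\<dots> = (\<integral>\<omega>. u (fst (\<omega> n)) \<partial>?M)"
    by (rule expectation_state[symmetric])
  finally show ?thesis
    by simp
qed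

lemma expected_average_eq_sum:
  fixes \<mu> :: "'s::finite pmf" and \<pi> :: "('s, 'a::finite) controller"
  shows "expected_average r \<mu> \<pi> \<kappa> n =
    (\<Sum>k<n. \<integral>\<omega>. r (fst (\<omega> k)) (snd (\<omega> k)) \<partial>trajectory_law \<mu> \<pi> \<kappa>) / real n"
proof -
  have "integrable (trajectory_law \<mu> \<pi> \<kappa>) (\<lambda>\<omega>. r (fst (\<omega> k)) (snd (\<omega> k)))" for k
    by (rule integrable_history[of _ _ _ "\<lambda>_ z. r (fst z) (snd z)"])
  then show ?thesis
    by (simp add: expected_average_def)
qed

lemma expected_average_uminus:
  "expected_average (\<lambda>s a. - r s a) \<mu> \<pi> \<kappa> n = - expected_average r \<mu> \<pi> \<kappa> n"
  by (simp add: expected_average_def sum_negf)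

text \<open>
  Summing the drift inequality over the first \<open>n\<close> steps leaves only the potentials at times \<open>0\<close> and
  \<open>n\<close>, which contribute at most \<open>2 * B\<close> in total.
\<close>

lemma expected_average_le:
  fixes \<mu> :: "'s::finite pmf" and \<pi> :: "('s, 'a::finite) controller"
  assumes drift: "\<And>h. (\<Sum>a\<in>UNIV. \<Sum>s'\<in>UNIV.
      pmf (\<pi> h) a * pmf (\<kappa> h a) s' * (r (snd h) a - c + u s')) \<le> u (snd h)"
    and bound: "\<And>s. \<bar>u s\<bar> \<le> B" and n: "n > 0"
  shows "expected_average r \<mu> \<pi> \<kappa> n \<le> c + 2 * B / real n"
proof -
  let ?M = "trajectory_law \<mu> \<pi> \<kappa>"
  interpret prob_space ?M
    by (rule prob_space_trajectory_law)
  let ?v = "\<lambda>n. \<integral>\<omega>. u (fst (\<omega> n)) \<partial>?M"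
  let ?r = "\<lambda>n. \<integral>\<omega>. r (fst (\<omega> n)) (snd (\<omega> n)) \<partial>?M"
  have telescope: "(\<Sum>k<n. ?r k) + ?v n \<le> real n * c + ?v 0"
  proof (induction n)
    case (Suc n)
    then show ?case
      using expected_reward_drift[OF drift, of \<mu> n] by (simp add: algebra_simps)
  qed simp
  have int_u: "integrable ?M (\<lambda>\<omega>. u (fst (\<omega> k)))" for k
    by (rule integrable_history[of _ _ _ "\<lambda>_ z. u (fst z)"])
  have "?v 0 \<le> B"
    using integral_mono[OF int_u[of 0], of "\<lambda>_. B"] bound by (simp add: abs_le_iff prob_space)
  moreover have "- B \<le> ?v n"
    using integral_mono[OF _ int_u[of n], of "\<lambda>_. - B"] bound
    by (simp add: abs_le_iff prob_space minus_le_iff)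
  ultimately have "(\<Sum>k<n. ?r k) \<le> real n * c + 2 * B"
    using telescope by simp
  also have "\<dots> = (c + 2 * B / real n) * real n"
    using n by (simp add: field_simps)
  finally show ?thesis
    using n by (simp add: expected_average_eq_sum pos_divide_le_eq)
qed

lemma upper_gain_le:
  fixes \<mu> :: "'s::finite pmf" and \<pi> :: "('s, 'a::finite) controller"
  assumes drift: "\<And>h. (\<Sum>a\<in>UNIV. \<Sum>s'\<in>UNIV.
      pmf (\<pi> h) a * pmf (\<kappa> h a) s' * (r (snd h) a - c + u s')) \<le> u (snd h)"
  shows "upper_gain r \<mu> \<pi> \<kappa> \<le> ereal c"
proof -
  have bound: "\<bar>u s\<bar> \<le> (\<Sum>s\<in>UNIV. \<bar>u s\<bar>)" for s
    by (rule member_le_sum) auto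
  let ?f = "\<lambda>n. ereal (c + 2 * (\<Sum>s\<in>UNIV. \<bar>u s\<bar>) / real n)"
  have "(\<lambda>n. c + 2 * (\<Sum>s\<in>UNIV. \<bar>u s\<bar>) / real n) \<longlonglongrightarrow> c + 0"
    by (intro tendsto_intros lim_const_over_n)
  then have "limsup ?f = ereal c"
    by (intro lim_imp_Limsup) auto
  moreover have "upper_gain r \<mu> \<pi> \<kappa> \<le> limsup ?f"
    unfolding upper_gain_def
    by (intro Limsup_mono eventually_mono[OF eventually_gt_at_top[of 0]])
      (simp add: expected_average_le[OF drift bound])
  ultimately show ?thesis
    by simp
qed

text \<open>
  Changing the signs of \<open>r\<close>, \<open>u\<close> and \<open>c\<close> reverses the drift inequality and exchanges the two gains.
\<close>

lemma lower_gain_ge: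
  fixes \<mu> :: "'s::finite pmf" and \<pi> :: "('s, 'a::finite) controller"
  assumes drift: "\<And>h. u (snd h) \<le> (\<Sum>a\<in>UNIV. \<Sum>s'\<in>UNIV.
      pmf (\<pi> h) a * pmf (\<kappa> h a) s' * (r (snd h) a - c + u s'))"
  shows "ereal c \<le> lower_gain r \<mu> \<pi> \<kappa>"
proof -
  have "upper_gain (\<lambda>s a. - r s a) \<mu> \<pi> \<kappa> \<le> ereal (- c)"
  proof (rule upper_gain_le)
    fix h :: "('s, 'a) history"
    have "(\<Sum>a\<in>UNIV. \<Sum>s'\<in>UNIV.
          pmf (\<pi> h) a * pmf (\<kappa> h a) s' * (- r (snd h) a - - c + - u s')) =
        - (\<Sum>a\<in>UNIV. \<Sum>s'\<in>UNIV. pmf (\<pi> h) a * pmf (\<kappa> h a) s' * (r (snd h) a - c + u s'))"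
      unfolding sum_negf[symmetric] by (intro sum.cong refl) algebra
    then show "(\<Sum>a\<in>UNIV. \<Sum>s'\<in>UNIV.
        pmf (\<pi> h) a * pmf (\<kappa> h a) s' * (- r (snd h) a - - c + - u s')) \<le> - u (snd h)"
      using drift[of h] by simp
  qed
  moreover have "upper_gain (\<lambda>s a. - r s a) \<mu> \<pi> \<kappa> = - lower_gain r \<mu> \<pi> \<kappa>"
    unfolding upper_gain_def lower_gain_def expected_average_uminus uminus_ereal.simps(1)[symmetric]
    by (rule ereal_Limsup_uminus)
  ultimately have "- lower_gain r \<mu> \<pi> \<kappa> \<le> - ereal c"
    by simp
  then show ?thesis
    by (simp only: ereal_minus_le_minus)
qed

section \<open>Near-optimal choices in the Bellman equation\<close>

text \<open>
  A tolerance in the near-optimal choices can be moved into the gain constant, because the weights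
  have total mass one. This gives the choices the form that the drift lemmas ask for.
\<close>

lemma pmf_average_shift:
  fixes \<phi> :: "'a::finite pmf" and p :: "'a \<Rightarrow> 's::finite pmf"
  shows "(\<Sum>a\<in>UNIV. \<Sum>s'\<in>UNIV. pmf \<phi> a * pmf (p a) s' * (f a - (c + d) + u s')) =
    (\<Sum>a\<in>UNIV. \<Sum>s'\<in>UNIV. pmf \<phi> a * pmf (p a) s' * (f a - c + u s')) - (d :: real)"
proof -
  have "(\<Sum>a\<in>UNIV. \<Sum>s'\<in>UNIV. pmf \<phi> a * pmf (p a) s' * d) =
      (\<Sum>a\<in>UNIV. pmf \<phi> a * (\<Sum>s'\<in>UNIV. pmf (p a) s')) * d"
    by (simp only: sum_distrib_left sum_distrib_right)
  also have "\<dots> = d"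
    by (simp add: sum_pmf_UNIV)
  finally have "(\<Sum>a\<in>UNIV. \<Sum>s'\<in>UNIV. pmf \<phi> a * pmf (p a) s' * d) = d" .
  moreover have "w * (f a - (c + d) + u s') = w * (f a - c + u s') - w * d" for w a s'
    by (simp add: ring_distribs)
  ultimately show ?thesis
    by (simp only: sum_subtractf)
qed

text \<open>
  The bound is uniform in both laws; it makes the infima and suprema over the possibly infinite sets
  \<open>P s\<close> and \<open>Q\<close> genuine.
\<close>

lemma pmf_average_bounded:
  fixes f :: "'a::finite \<Rightarrow> 's::finite \<Rightarrow> real"
  shows "\<bar>\<Sum>a\<in>UNIV. \<Sum>s'\<in>UNIV. pmf \<phi> a * pmf (p a) s' * f a s'\<bar> \<le> (\<Sum>a\<in>UNIV. \<Sum>s'\<in>UNIV. \<bar>f a s'\<bar>)"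
proof -
  have "\<bar>pmf \<phi> a * pmf (p a) s' * f a s'\<bar> \<le> \<bar>f a s'\<bar>" for a s'
  proof -
    have "pmf \<phi> a * pmf (p a) s' \<le> 1"
      by (intro mult_le_one pmf_le_1 pmf_nonneg)
    then have "pmf \<phi> a * pmf (p a) s' * \<bar>f a s'\<bar> \<le> 1 * \<bar>f a s'\<bar>"
      by (rule mult_right_mono) simp
    then show ?thesis
      by (simp add: abs_mult)
  qed
  then show ?thesis
    by (intro order_trans[OF sum_abs] sum_mono)
qed

lemma bellman_solutionD:
  assumes "bellman_solution r Q P u \<alpha>"
  shows "u s = (SUP \<phi>\<in>Q. INF p\<in>P s.
    \<Sum>a\<in>UNIV. \<Sum>s'\<in>UNIV. pmf \<phi> a * pmf (p a) s' * (r s a - \<alpha> + u s'))"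
  using assms unfolding bellman_solution_def by (rule spec)

lemma bellman_adversary_choice:
  assumes bellman: "bellman_solution r Q P u \<alpha>" and P: "P s \<noteq> {}"
    and \<phi>: "\<phi> \<in> Q" and e: "e > 0"
  shows "\<exists>p\<in>P s. (\<Sum>a\<in>UNIV. \<Sum>s'\<in>UNIV.
    pmf \<phi> a * pmf (p a) s' * (r s a - (\<alpha> + e) + u s')) \<le> u s"
proof -
  let ?V = "\<lambda>\<phi> p. \<Sum>a\<in>UNIV. \<Sum>s'\<in>UNIV. pmf \<phi> a * pmf (p a) s' * (r s a - \<alpha> + u s')"
  define B where "B = (\<Sum>a\<in>UNIV. \<Sum>s'\<in>UNIV. \<bar>r s a - \<alpha> + u s'\<bar>)"
  have B: "\<bar>?V \<phi> p\<bar> \<le> B" for \<phi> p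
    unfolding B_def by (rule pmf_average_bounded)
  obtain p0 where p0: "p0 \<in> P s"
    using P by blast
  have "bdd_below (?V \<phi> ` P s)" for \<phi>
    using B by (intro bdd_belowI2[of _ "- B"]) (simp add: abs_le_iff minus_le_iff)
  then have "(INF p\<in>P s. ?V \<phi> p) \<le> B" for \<phi>
    using B[of \<phi> p0] by (intro cINF_lower2[OF _ p0]) (simp_all add: abs_le_iff)
  then have "bdd_above ((\<lambda>\<phi>. INF p\<in>P s. ?V \<phi> p) ` Q)"
    by (intro bdd_aboveI2)
  then have "(INF p\<in>P s. ?V \<phi> p) \<le> (SUP \<phi>\<in>Q. INF p\<in>P s. ?V \<phi> p)"
    by (rule cSUP_upper[OF \<phi>])
  also have "\<dots> = u s"
    by (rule bellman_solutionD[OF bellman, symmetric])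
  also have "\<dots> < u s + e"
    using e by simp
  finally have "Inf (?V \<phi> ` P s) < u s + e" .
  then obtain p where "p \<in> P s" "?V \<phi> p < u s + e"
    using cInf_lessD[of "?V \<phi> ` P s"] P by blast
  then show ?thesis
    unfolding pmf_average_shift by (intro bexI[of _ p]) auto
qed

lemma bellman_controller_choice:
  assumes bellman: "bellman_solution r Q P u \<alpha>" and Q: "Q \<noteq> {}" and e: "e > 0"
  shows "\<exists>\<phi>\<in>Q. \<forall>p\<in>P s. u s \<le> (\<Sum>a\<in>UNIV. \<Sum>s'\<in>UNIV.
    pmf \<phi> a * pmf (p a) s' * (r s a - (\<alpha> - e) + u s'))"
proof -
  let ?V = "\<lambda>\<phi> p. \<Sum>a\<in>UNIV. \<Sum>s'\<in>UNIV. pmf \<phi> a * pmf (p a) s' * (r s a - \<alpha> + u s')"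
  define B where "B = (\<Sum>a\<in>UNIV. \<Sum>s'\<in>UNIV. \<bar>r s a - \<alpha> + u s'\<bar>)"
  have B: "\<bar>?V \<phi> p\<bar> \<le> B" for \<phi> p
    unfolding B_def by (rule pmf_average_bounded)
  have "u s - e < u s"
    using e by simp
  also have "u s = (SUP \<phi>\<in>Q. INF p\<in>P s. ?V \<phi> p)"
    by (rule bellman_solutionD[OF bellman])
  finally have "u s - e < (SUP \<phi>\<in>Q. INF p\<in>P s. ?V \<phi> p)" .
  then obtain \<phi> where \<phi>: "\<phi> \<in> Q" "u s - e < (INF p\<in>P s. ?V \<phi> p)"
    using less_cSupD[of "(\<lambda>\<phi>. INF p\<in>P s. ?V \<phi> p) ` Q"] Q by blast
  have "bdd_below (?V \<phi> ` P s)"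
    using B by (intro bdd_belowI2[of _ "- B"]) (simp add: abs_le_iff minus_le_iff)
  then have "u s \<le> ?V \<phi> p + e" if "p \<in> P s" for p
    using cINF_lower[OF _ that] \<phi>(2) by fastforce
  moreover have "(\<Sum>a\<in>UNIV. \<Sum>s'\<in>UNIV.
      pmf \<phi> a * pmf (p a) s' * (r s a - (\<alpha> - e) + u s')) = ?V \<phi> p + e" for p
    using pmf_average_shift[of \<phi> p "r s" \<alpha> "- e" u] by simp
  ultimately show ?thesis
    using \<phi>(1) by (intro bexI[of _ \<phi>]) auto
qed

section \<open>The gain of the Bellman equation is the value of the game\<close>

text \<open>
  Near-optimal action laws, one for each state, form a stationary policy that guarantees \<open>\<alpha> - e\<close>
  whatever the adversary does.
\<close>

lemma lower_value_ge:
  fixes r :: "'s::finite \<Rightarrow> 'a::finite \<Rightarrow> real"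
  assumes Q: "Q \<noteq> {}" and bellman: "bellman_solution r Q P u \<alpha>"
    and C: "stationary_controllers Q \<subseteq> C" and K: "K \<subseteq> history_adversaries P"
  shows "ereal \<alpha> \<le> lower_value r \<mu> C K"
proof (rule ereal_le_epsilon2)
  fix e :: real
  assume e: "0 < e"
  let ?V = "\<lambda>s \<phi> p. \<Sum>a\<in>UNIV. \<Sum>s'\<in>UNIV. pmf \<phi> a * pmf (p a) s' * (r s a - (\<alpha> - e) + u s')"
  have "\<forall>s. \<exists>\<phi>. \<phi> \<in> Q \<and> (\<forall>p\<in>P s. u s \<le> ?V s \<phi> p)"
    using bellman_controller_choice[OF bellman Q e] unfolding Bex_def by (rule allI)
  from choice[OF this] obtain \<Delta> where "\<forall>s. \<Delta> s \<in> Q \<and> (\<forall>p\<in>P s. u s \<le> ?V s (\<Delta> s) p)" ..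
  then have \<Delta>: "\<Delta> s \<in> Q" "p \<in> P s \<Longrightarrow> u s \<le> ?V s (\<Delta> s) p" for s p
    by blast+
  define \<pi> :: "('s, 'a) controller" where "\<pi> = (\<lambda>h. \<Delta> (snd h))"
  have "\<pi> \<in> stationary_controllers Q"
    using \<Delta>(1) unfolding \<pi>_def stationary_controllers_def history_controllers_def
    by (auto intro!: exI[of _ \<Delta>])
  with C have "\<pi> \<in> C" ..
  have "ereal (\<alpha> - e) \<le> (INF \<kappa>\<in>K. lower_gain r \<mu> \<pi> \<kappa>)"
  proof (rule INF_greatest, rule lower_gain_ge)
    fix \<kappa> h
    assume "\<kappa> \<in> K"
    then have "\<kappa> h \<in> P (snd h)"
      using K unfolding history_adversaries_def by blast
    then show "u (snd h) \<le> ?V (snd h) (\<pi> h) (\<kappa> h)"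
      unfolding \<pi>_def by (rule \<Delta>(2))
  qed
  also have "\<dots> \<le> lower_value r \<mu> C K"
    unfolding lower_value_def by (rule SUP_upper) fact
  finally have "ereal (\<alpha> - e) + ereal e \<le> lower_value r \<mu> C K + ereal e"
    by (rule add_right_mono)
  then show "ereal \<alpha> \<le> lower_value r \<mu> C K + ereal e"
    by simp
qed

text \<open>
  The adversary answers the action law that the controller is about to use. The last hypothesis asks
  that \<open>K\<close> contain these answers: they depend on the history only through that law and the current
  state, which is why stationary adversaries suffice against stationary controllers.
\<close>

lemma upper_value_le:
  fixes r :: "'s::finite \<Rightarrow> 'a::finite \<Rightarrow> real"
  assumes P: "\<And>s. P s \<noteq> {}" and bellman: "bellman_solution r Q P u \<alpha>"
    and C: "C \<subseteq> history_controllers Q"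
    and K: "\<And>\<pi> best. \<lbrakk>\<pi> \<in> C; \<And>\<phi> s. \<phi> \<in> Q \<Longrightarrow> best \<phi> s \<in> P s\<rbrakk> \<Longrightarrow> (\<lambda>h. best (\<pi> h) (snd h)) \<in> K"
  shows "upper_value r \<mu> C K \<le> ereal \<alpha>"
  unfolding upper_value_def
proof (rule SUP_least, rule ereal_le_epsilon2)
  fix \<pi> and e :: real
  assume \<pi>: "\<pi> \<in> C" and e: "0 < e"
  let ?V = "\<lambda>s \<phi> p. \<Sum>a\<in>UNIV. \<Sum>s'\<in>UNIV. pmf \<phi> a * pmf (p a) s' * (r s a - (\<alpha> + e) + u s')"
  define best where "best \<phi> s = (SOME p. p \<in> P s \<and> ?V s \<phi> p \<le> u s)" for \<phi> s
  have best: "best \<phi> s \<in> P s" "?V s \<phi> (best \<phi> s) \<le> u s" if "\<phi> \<in> Q" for \<phi> s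
    using someI_ex[OF bellman_adversary_choice[OF bellman P that e, unfolded Bex_def]]
    unfolding best_def by (rule conjunct1, rule conjunct2)
  have "(INF \<kappa>\<in>K. upper_gain r \<mu> \<pi> \<kappa>) \<le> upper_gain r \<mu> \<pi> (\<lambda>h. best (\<pi> h) (snd h))"
    by (rule INF_lower) (rule K[OF \<pi> best(1)])
  also have "\<dots> \<le> ereal (\<alpha> + e)"
  proof (rule upper_gain_le)
    fix h
    have "\<pi> h \<in> Q"
      using \<pi> C unfolding history_controllers_def by blast
    then show "?V (snd h) (\<pi> h) (best (\<pi> h) (snd h)) \<le> u (snd h)"
      by (rule best(2))
  qed
  finally show "(INF \<kappa>\<in>K. upper_gain r \<mu> \<pi> \<kappa>) \<le> ereal \<alpha> + ereal e"
    by simp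
qed

lemma lower_value_le_upper_value: "lower_value r \<mu> C K \<le> upper_value r \<mu> C K"
  unfolding lower_value_def upper_value_def lower_gain_def upper_gain_def
  by (intro SUP_mono' INF_mono' Liminf_le_Limsup) simp

lemma bellman_gain_eq_values:
  fixes r :: "'s::finite \<Rightarrow> 'a::finite \<Rightarrow> real"
  assumes Q: "Q \<noteq> {}" and P: "\<And>s. P s \<noteq> {}" and bellman: "bellman_solution r Q P u \<alpha>"
    and C: "stationary_controllers Q \<subseteq> C" "C \<subseteq> history_controllers Q"
    and K: "K \<subseteq> history_adversaries P"
      "\<And>\<pi> best. \<lbrakk>\<pi> \<in> C; \<And>\<phi> s. \<phi> \<in> Q \<Longrightarrow> best \<phi> s \<in> P s\<rbrakk> \<Longrightarrow> (\<lambda>h. best (\<pi> h) (snd h)) \<in> K"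
  shows "ereal \<alpha> = upper_value r \<mu> C K \<and> ereal \<alpha> = lower_value r \<mu> C K"
  using lower_value_ge[OF Q bellman C(1) K(1)] lower_value_le_upper_value[of r \<mu> C K]
    upper_value_le[OF P bellman C(2) K(2), of \<mu>]
  by (meson order.antisym order.trans)

theorem theorem1:
  fixes r :: "'s::finite \<Rightarrow> 'a::finite \<Rightarrow> real"
    and Q :: "'a pmf set"
    and P :: "'s \<Rightarrow> ('a \<Rightarrow> 's pmf) set"
    and u' :: "'s \<Rightarrow> real" and \<alpha>' :: real
  assumes r: "\<And>s a. r s a \<in> {0..1}"
    and Q: "Q \<noteq> {}"
    and P: "\<And>s. P s \<noteq> {}"
    and \<alpha>': "\<alpha>' \<in> {0..1}"
    and bellman: "bellman_solution r Q P u' \<alpha>'"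
  shows "(\<forall>\<mu> :: 's pmf.
      ereal \<alpha>' = upper_value r \<mu> (history_controllers Q) (history_adversaries P) \<and>
      ereal \<alpha>' = lower_value r \<mu> (history_controllers Q) (history_adversaries P) \<and>
      ereal \<alpha>' = upper_value r \<mu> (stationary_controllers Q) (history_adversaries P) \<and>
      ereal \<alpha>' = lower_value r \<mu> (stationary_controllers Q) (history_adversaries P) \<and>
      ereal \<alpha>' = upper_value r \<mu> (stationary_controllers Q) (stationary_adversaries P) \<and>
      ereal \<alpha>' = lower_value r \<mu> (stationary_controllers Q) (stationary_adversaries P)) \<and>
    (\<forall>u \<alpha>. \<alpha> \<in> {0..1} \<and> bellman_solution r Q P u \<alpha> \<longrightarrow> \<alpha> = \<alpha>')"
proof -
  have controllers: "stationary_controllers Q \<subseteq> history_controllers Q"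
    by (auto simp: stationary_controllers_def)
  have adversaries: "stationary_adversaries P \<subseteq> history_adversaries P"
    by (auto simp: stationary_adversaries_def)
  have reply_history: "(\<lambda>h. best (\<pi> h) (snd h)) \<in> history_adversaries P"
    if "\<pi> \<in> history_controllers Q" "\<And>\<phi> s. \<phi> \<in> Q \<Longrightarrow> best \<phi> s \<in> P s" for \<pi> best
    using that by (auto simp: history_controllers_def history_adversaries_def)
  \<comment> \<open>Against \<open>\<Delta>\<close> the reply in state \<open>s\<close> is always \<open>best (\<Delta> s) s\<close>, one fixed kernel.\<close>
  have reply_stationary: "(\<lambda>h. best (\<pi> h) (snd h)) \<in> stationary_adversaries P"
    if \<pi>: "\<pi> \<in> stationary_controllers Q" and best: "\<And>\<phi> s. \<phi> \<in> Q \<Longrightarrow> best \<phi> s \<in> P s" for \<pi> best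
  proof -
    obtain \<Delta> where "range \<Delta> \<subseteq> Q" "\<And>h. \<pi> h = \<Delta> (snd h)"
      using \<pi> by (auto simp: stationary_controllers_def)
    then show ?thesis
      using best reply_history[of \<pi> best] \<pi> controllers
      by (auto simp: stationary_adversaries_def rectangular_set_def
          intro!: bexI[of _ "\<lambda>s. best (\<Delta> s) s"])
  qed
  have hh: "ereal \<alpha> = upper_value r \<mu> (history_controllers Q) (history_adversaries P) \<and>
      ereal \<alpha> = lower_value r \<mu> (history_controllers Q) (history_adversaries P)"
    if "bellman_solution r Q P u \<alpha>" for u \<alpha> \<mu>
    by (rule bellman_gain_eq_values[OF Q P that controllers order_refl order_refl reply_history])
  have sh: "ereal \<alpha>' = upper_value r \<mu> (stationary_controllers Q) (history_adversaries P) \<and>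
      ereal \<alpha>' = lower_value r \<mu> (stationary_controllers Q) (history_adversaries P)" for \<mu>
    using controllers
    by (intro bellman_gain_eq_values[OF Q P bellman order_refl controllers order_refl])
      (blast intro: reply_history)
  have ss: "ereal \<alpha>' = upper_value r \<mu> (stationary_controllers Q) (stationary_adversaries P) \<and>
      ereal \<alpha>' = lower_value r \<mu> (stationary_controllers Q) (stationary_adversaries P)" for \<mu>
    by (rule bellman_gain_eq_values[OF Q P bellman order_refl controllers adversaries
          reply_stationary])
  \<comment> \<open>Both constants equal the same value of the game, started from any law.\<close>
  have "\<alpha> = \<alpha>'" if "bellman_solution r Q P u \<alpha>" for u \<alpha>
    using hh[OF that, of "return_pmf undefined"] hh[OF bellman, of "return_pmf undefined"]
    by (metis ereal.inject)
  then show ?thesis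
    using hh[OF bellman] sh ss by blast
qed

end
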